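(* Let $$\phi_0(z)=\sqrt2-(\sqrt2-1)\sqrt{\frac{1-z}{1+2(\sqrt2-1)z}}$$ and $$f_0(z)=z\left(\frac{\sqrt{1-z}+\sqrt{1+2(\sqrt2-1)z}}{2}\right)^{2(\sqrt2-1)}\exp(p_0(z)),$$ where $$p_0(z)=\sqrt{2(\sqrt2-1)}\,\tan^{-1}\left(\sqrt{2(\sqrt2-1)}\left(\frac{\sqrt{1+2(\sqrt2-1)z}-\sqrt{1-z}}{\sqrt{1+2(\sqrt2-1)z}+2(\sqrt2-1)\sqrt{1-z}}\right)\right).$$ If $f\in\mathcal{S}^*_{RL}$, then $f\in\Omega$ in the disc $|z|<r_0$, i.e. $|zf'(z)-f(z)|<\frac12$ for all $|z|<r_0$, where $r_0\approx0.768$ is the smallest positive root of $2(1-\phi_0(-r))f_0(r)-1=0$.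
   Context: $\mathbb{D}=\{z\in\mathbb{C}:|z|<1\}$. $\mathcal{A}$ is the class of analytic functions $f$ on $\mathbb{D}$ with $f(0)=0$, $f'(0)=1$. $\Omega=\{f\in\mathcal{A}:|zf'(z)-f(z)|<\frac12,\ z\in\mathbb{D}\}$; "$f\in\Omega$ in the disc $|z|<r_0$" means that the defining inequality holds for all $|z|<r_0$. $\mathcal{S}^*_{RL}$ is the class of $f\in\mathcal{A}$ with $zf'(z)/f(z)\prec\phi_0(z)$, with $\phi_0$ the function given in the claim, where $p\prec\phi$ means $p=\phi\circ\omega$ for some analytic $\omega:\mathbb{D}\to\mathbb{D}$ with $\omega(0)=0$. All roots and powers are principal branches. *)

theory Defs
  imports "HOL-Analysis.Analysis"
begin

abbreviation unit_disc :: "complex set" where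
  "unit_disc \<equiv> ball 0 1"

definition class_A :: "(complex \<Rightarrow> complex) set" where
  "class_A = {f. f holomorphic_on unit_disc \<and> f 0 = 0 \<and> deriv f 0 = 1}"

(* Membership in Omega "in the disc |z| < r"; the class Omega itself is the case r = 1. *)
definition class_Omega_in :: "real \<Rightarrow> (complex \<Rightarrow> complex) set" where
  "class_Omega_in r = {f \<in> class_A. \<forall>z. cmod z < r \<longrightarrow> cmod (z * deriv f z - f z) < 1 / 2}"

definition subordinate :: "(complex \<Rightarrow> complex) \<Rightarrow> (complex \<Rightarrow> complex) \<Rightarrow> bool"
    (infix "\<prec>\<^sub>D" 50) where
  "p \<prec>\<^sub>D \<phi> \<longleftrightarrow> (\<exists>\<omega>. \<omega> holomorphic_on unit_disc \<and> \<omega> ` unit_disc \<subseteq> unit_disc \<and> \<omega> 0 = 0 \<and>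
      (\<forall>z\<in>unit_disc. p z = \<phi> (\<omega> z)))"

definition phi0 :: "complex \<Rightarrow> complex" where
  "phi0 z = complex_of_real (sqrt 2) -
     complex_of_real (sqrt 2 - 1) * csqrt ((1 - z) / (1 + complex_of_real (2 * (sqrt 2 - 1)) * z))"

definition p0 :: "complex \<Rightarrow> complex" where
  "p0 z = (let a = complex_of_real (2 * (sqrt 2 - 1)); c = csqrt a in
     c * Arctan (c * ((csqrt (1 + a * z) - csqrt (1 - z)) / (csqrt (1 + a * z) + a * csqrt (1 - z)))))"

definition f0 :: "complex \<Rightarrow> complex" where
  "f0 z = (let a = complex_of_real (2 * (sqrt 2 - 1)) in
     z * ((csqrt (1 - z) + csqrt (1 + a * z)) / 2) powr a * exp (p0 z))"

(* For f in class_A the singularity of z f'(z) / f(z) at the origin is removable with value 1.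
   At any other zero of f the HOL quotient is 0, which phi0 does not take on the unit disc,
   so the class S*_RL below contains no function with such a zero. *)
definition starlike_quotient :: "(complex \<Rightarrow> complex) \<Rightarrow> complex \<Rightarrow> complex" where
  "starlike_quotient f z = (if z = 0 then 1 else z * deriv f z / f z)"

definition class_S_RL :: "(complex \<Rightarrow> complex) set" where
  "class_S_RL = {f \<in> class_A. starlike_quotient f \<prec>\<^sub>D phi0}"

end

(* Write f for a function of the class and omega for its Schwarz function. Then |z f' - f| =
   |f| |phi0 (omega z) - 1|. Among all w with |w| <= r, Re (phi0 w) is largest at w = r and
   |phi0 w - 1| is largest at w = -r. Since f0 solves r f0' = f0 phi0 on (0, 1), the first fact
   makes |f (t e)| / f0 t nonincreasing in t for |e| = 1; its limit at 0 is 1, so |f z| <= f0 |z|.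
   Hence |z f' - f| <= (1 - phi0 (-r)) f0 r, and the right-hand side is increasing in r. *)
theory Submission
  imports Defs "HOL-Complex_Analysis.Complex_Analysis"
begin

text \<open>Of the two extremal facts, the one at w = r is a Moebius computation; the one at w = -r
  is the obstacle. Positivity of Taylor coefficients does not give it: 1 - phi0 (-z) has radius of
  convergence 1 because of the branch point at z = -1, yet it is analytic at z = 1, so by
  Pringsheim's theorem its coefficients are not all nonnegative. Instead |w| is bounded from below
  on circles about 1 in the plane of the square root, which ends in a polynomial inequality. It
  needs a >= 1/2, and the actual coefficient 2 (sqrt 2 - 1) is about 0.828. The growth comparison
  works with squared moduli and so does not presuppose that f has no zeros off the origin. Zeros are
  excluded separately: the constants make phi0 (-1) = 0, hence |phi0 w - 1| < 1 in the disc, whereas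
  a zero of f would give the value 0 of the HOL quotient, at distance exactly 1 from 1. The radius
  is located by evaluating the increasing function \<open>radius_fun\<close> at 0.768 - 0.0005 and
  0.768 + 0.0005 with rational bounds.\<close>

section \<open>The square root of the Moebius map\<close>

text \<open>Inversion maps the disc of radius b about 1 to the disc with real diameter from 1/(1+b)
  to 1/(1-b); the bound is its left end.\<close>

lemma Re_inverse_ge_of_cmod_le:
  fixes u :: complex
  assumes "cmod (u - 1) \<le> b" "b < 1"
  shows "1 / (1 + b) \<le> Re (1 / u)"
proof -
  have b0: "0 \<le> b" using assms(1) norm_ge_zero order_trans by blast
  have un: "cmod u \<le> 1 + b"
    using norm_triangle_ineq[of "u - 1" 1] assms by simp
  have u0: "u \<noteq> 0" using assms by auto
  have "(cmod (u - 1))\<^sup>2 \<le> b\<^sup>2" using assms b0 by (intro power_mono) auto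
  hence 1: "(cmod u)\<^sup>2 + 1 - b\<^sup>2 \<le> 2 * Re u"
    unfolding cmod_power2 by (simp add: power2_eq_square algebra_simps)
  have "(cmod u)\<^sup>2 * (1 - b) \<le> (1 + b)\<^sup>2 * (1 - b)"
    using un assms by (intro mult_right_mono power_mono) auto
  hence "2 * (cmod u)\<^sup>2 \<le> ((cmod u)\<^sup>2 + 1 - b\<^sup>2) * (1 + b)"
    by (simp add: power2_eq_square algebra_simps)
  also have "\<dots> \<le> 2 * Re u * (1 + b)" using 1 b0 by (intro mult_right_mono) auto
  finally have "(cmod u)\<^sup>2 \<le> Re u * (1 + b)" by simp
  moreover have "Re (1 / u) = Re u / (cmod u)\<^sup>2" by (simp add: Re_divide cmod_power2)
  moreover have "(cmod u)\<^sup>2 > 0" using u0 by simp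
  ultimately show ?thesis using b0 by (simp add: pos_le_divide_eq pos_divide_le_eq)
qed

lemma one_plus_mult_ne_zero:
  fixes w :: complex and a :: real
  assumes "0 \<le> a" "a < 1" "cmod w \<le> r" "r < 1"
  shows "1 + of_real a * w \<noteq> 0"
proof
  assume "1 + of_real a * w = 0"
  hence "of_real a * w = - 1" by (simp add: eq_neg_iff_add_eq_0 add.commute)
  hence "a * cmod w = 1" using assms by (metis abs_of_nonneg norm_minus_cancel norm_mult norm_of_real norm_one)
  moreover have "a * cmod w \<le> a * 1" using assms by (intro mult_left_mono) auto
  ultimately show False using assms by simp
qed

text \<open>Partial fractions, q = ((1+a)/a) / (1+aw) - 1/a, reduce Re q to the inversion bound. The
  half-angle formula Re (csqrt q) = sqrt ((|q| + Re q) / 2) then gives Re (csqrt q) >= sqrt (Re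
  q).\<close>

lemma Re_csqrt_moebius_ge:
  fixes w :: complex and a :: real
  assumes a: "0 < a" "a < 1" and w: "cmod w \<le> r" and r: "r < 1"
  shows "sqrt ((1 - r) / (1 + a * r)) \<le> Re (csqrt ((1 - w) / (1 + of_real a * w)))"
proof -
  let ?q = "(1 - w) / (1 + of_real a * w)"
  have r0: "0 \<le> r" using w norm_ge_zero order_trans by blast
  have ne: "1 + of_real a * w \<noteq> 0" using a by (intro one_plus_mult_ne_zero[OF _ _ w r]) auto
  have "1 / (1 + a * r) \<le> Re (1 / (1 + of_real a * w))"
  proof (rule Re_inverse_ge_of_cmod_le)
    show "cmod (1 + of_real a * w - 1) \<le> a * r" using a w by (simp add: norm_mult)
    show "a * r < 1" using mult_right_mono[of a 1 r] a r r0 by linarith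
  qed
  hence "(1 + a) / a * (1 / (1 + a * r)) - 1 / a \<le> (1 + a) / a * Re (1 / (1 + of_real a * w)) - 1 / a"
    using a by (intro diff_right_mono mult_left_mono) auto
  moreover have "(1 + a) / a * (1 / (1 + a * r)) - 1 / a = (1 - r) / (1 + a * r)"
    using a r0 by (simp add: divide_simps add_pos_nonneg add_nonneg_eq_0_iff) (simp add: algebra_simps)
  moreover have "?q = of_real ((1 + a) / a) * (1 / (1 + of_real a * w)) - of_real (1 / a)"
    using a ne by (simp add: divide_simps) (simp add: algebra_simps)
  hence "Re ?q = (1 + a) / a * Re (1 / (1 + of_real a * w)) - 1 / a"
    by (simp only: minus_complex.sel times_complex.sel Re_complex_of_real Im_complex_of_real mult_zero_left diff_zero)
  ultimately have "(1 - r) / (1 + a * r) \<le> Re ?q" by linarith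
  also have "\<dots> \<le> (cmod ?q + Re ?q) / 2"
    using mult_left_mono[OF complex_Re_le_cmod[of ?q], of "1/2"] by argo
  finally show ?thesis by simp
qed

text \<open>This is \<open>cmod_one_plus_square_le\<close> squared, in the coordinates c = Re s - 1
  and R = |s - 1|: the first factor is |1 + a s^2|^2, and 4 + 4c + R^2 is |s + 1|^2. Equality at c =
  R, that is at s = 1 + R, explains the factor R - c of the difference.\<close>

lemma quadratic_bound_aux:
  fixes a c R :: real
  assumes a: "1/2 \<le> a" and c: "-1 \<le> c" "\<bar>c\<bar> \<le> R"
  shows "((1 + a)\<^sup>2 + 2 * a * (1 + a) * (2 * c + 2 * c\<^sup>2 - R\<^sup>2) + a\<^sup>2 * R\<^sup>2 * (4 + 4 * c + R\<^sup>2)) * (R + 2)\<^sup>2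
         \<le> (4 + 4 * c + R\<^sup>2) * (1 + a * (1 + R)\<^sup>2)\<^sup>2"
proof -
  have R0: "0 \<le> R" using c by linarith
  \<comment> \<open>The difference of both sides is 4 (1 + a) (R - c) L with L increasing and affine in c, so
      L only has to be checked at c = - min 1 R.\<close>
  define L where "L = a * (R + 2)\<^sup>2 * c + a * (R + 2) * (R\<^sup>2 + R + 2) - (1 + a)"
  have "0 \<le> L"
  proof (cases "R \<le> 1")
    case True
    have "a * (R + 2)\<^sup>2 * (- R) \<le> a * (R + 2)\<^sup>2 * c" using a c by (intro mult_left_mono) auto
    moreover have "a * (R + 2)\<^sup>2 * (- R) + a * (R + 2) * (R\<^sup>2 + R + 2) = a * (4 - R\<^sup>2)"
      by (simp add: power2_eq_square algebra_simps)
    moreover have "R\<^sup>2 \<le> 1\<^sup>2" using True R0 by (intro power_mono)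
    hence "a * 3 \<le> a * (4 - R\<^sup>2)" using a by (intro mult_left_mono) auto
    ultimately show ?thesis using a unfolding L_def by linarith
  next
    case False
    have "a * (R + 2)\<^sup>2 * (- 1) \<le> a * (R + 2)\<^sup>2 * c" using a c by (intro mult_left_mono) auto
    moreover have "a * (R + 2)\<^sup>2 * (- 1) + a * (R + 2) * (R\<^sup>2 + R + 2) = a * ((R + 2) * R\<^sup>2 - 2 * R)
       + a * (2 * R)"
      by (simp add: power2_eq_square algebra_simps)
    moreover have "3 * 1\<^sup>2 \<le> (R + 2) * R\<^sup>2" using False by (intro mult_mono power_mono) auto
    hence "a * 3 \<le> a * ((R + 2) * R\<^sup>2)" using a by (intro mult_left_mono) auto
    ultimately show ?thesis using a unfolding L_def by (simp add: algebra_simps)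
  qed
  \<comment> \<open>The left factor is (1+a) N + a^2 R^2 D, and (1 + a (1+R)^2)^2 is (1+a) K + (a R
    (R+2))^2. Both sides thus share the summand D (a R (R+2))^2, and N (R+2)^2 <= D K
    remains.\<close>
  define D N K where "D = 4 + 4 * c + R\<^sup>2" and "N = 1 + a + 2 * a * (2 * c + 2 * c\<^sup>2 - R\<^sup>2)"
    and "K = 2 * a * R * (R + 2) + 1 + a"
  have "0 \<le> 4 * (R - c) * L" using c \<open>0 \<le> L\<close> by (intro mult_nonneg_nonneg) auto
  moreover have "D * K - N * (R + 2)\<^sup>2 = 4 * (R - c) * L"
    unfolding D_def N_def K_def L_def by (simp add: power2_eq_square algebra_simps)
  ultimately have "N * (R + 2)\<^sup>2 \<le> D * K" by linarith
  hence "(1 + a) * (N * (R + 2)\<^sup>2) + D * (a * R * (R + 2))\<^sup>2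
      \<le> (1 + a) * (D * K) + D * (a * R * (R + 2))\<^sup>2"
    using a by (intro add_right_mono mult_left_mono) auto
  also have "\<dots> = D * (1 + a * (1 + R)\<^sup>2)\<^sup>2"
  proof -
    have "(1 + a * (1 + R)\<^sup>2)\<^sup>2 = (1 + a) * K + (a * R * (R + 2))\<^sup>2"
      unfolding K_def by (simp add: power2_eq_square algebra_simps)
    thus ?thesis by (simp add: algebra_simps)
  qed
  also have "(1 + a) * (N * (R + 2)\<^sup>2) + D * (a * R * (R + 2))\<^sup>2
      = ((1 + a) * N + a\<^sup>2 * R\<^sup>2 * D) * (R + 2)\<^sup>2"
    by (simp only: power_mult_distrib) (simp add: algebra_simps)
  also have "(1 + a) * N = (1 + a)\<^sup>2 + 2 * a * (1 + a) * (2 * c + 2 * c\<^sup>2 - R\<^sup>2)"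
    unfolding N_def by (simp add: power2_eq_square algebra_simps)
  finally show ?thesis unfolding D_def .
qed

text \<open>On the part of the circle |s - 1| = R in the closed right half-plane, |s + 1| / |1 + a
  s^2| is smallest at s = 1 + R. The bound on a is sharp: at s = 0 the inequality reads 3 <= 1 +
  4a.\<close>

lemma cmod_one_plus_square_le:
  fixes s :: complex and a :: real
  assumes a: "1/2 \<le> a" and s: "0 \<le> Re s"
  defines "R \<equiv> cmod (s - 1)"
  shows "cmod (1 + of_real a * s\<^sup>2) * (R + 2) \<le> cmod (s + 1) * (1 + a * (1 + R)\<^sup>2)"
proof -
  define c where "c = Re s - 1"
  define y where "y = Im s"
  have sc: "Re s = 1 + c" "Im s = y" by (auto simp: c_def y_def)
  have R2: "R\<^sup>2 = c\<^sup>2 + y\<^sup>2" unfolding R_def cmod_power2 by (simp add: c_def y_def)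
  have R0: "0 \<le> R" by (simp add: R_def)
  have c: "-1 \<le> c" "\<bar>c\<bar> \<le> R"
    using s abs_Re_le_cmod[of "s - 1"] by (auto simp: c_def R_def)
  have D: "(cmod (s + 1))\<^sup>2 = 4 + 4 * c + R\<^sup>2"
    unfolding R2 cmod_power2 using sc by (simp add: power2_eq_square algebra_simps)
  have N: "(cmod (1 + of_real a * s\<^sup>2))\<^sup>2 =
      (1 + a)\<^sup>2 + 2 * a * (1 + a) * (2 * c + 2 * c\<^sup>2 - R\<^sup>2) + a\<^sup>2 * R\<^sup>2 * (4 + 4 * c + R\<^sup>2)"
    unfolding R2 cmod_power2 using sc by (simp add: power2_eq_square algebra_simps)
  have "(cmod (1 + of_real a * s\<^sup>2) * (R + 2))\<^sup>2 \<le> (cmod (s + 1) * (1 + a * (1 + R)\<^sup>2))\<^sup>2"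
    unfolding power_mult_distrib D N by (rule quadratic_bound_aux[OF a c])
  thus ?thesis using a R0 by (elim power2_le_imp_le) auto
qed

lemma cmod_csqrt_moebius_minus_one_le:
  fixes w :: complex and a :: real
  assumes a: "1/2 \<le> a" "a < 1" and w: "cmod w \<le> r" and r: "r < 1"
  shows "cmod (csqrt ((1 - w) / (1 + of_real a * w)) - 1) \<le> sqrt ((1 + r) / (1 - a * r)) - 1"
proof -
  \<comment> \<open>Solving s^2 = (1 - w) / (1 + a w) for w reduces the claim to a lower bound for
      |w| = |s - 1| |s + 1| / |1 + a s^2| on the circle |s - 1| = R.\<close>
  define s where "s = csqrt ((1 - w) / (1 + of_real a * w))"
  define R where "R = cmod (s - 1)"
  have r0: "0 \<le> r" using w norm_ge_zero order_trans by blast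
  have R0: "0 \<le> R" by (simp add: R_def)
  have ne: "1 + of_real a * w \<noteq> 0" using a by (intro one_plus_mult_ne_zero[OF _ _ w r]) auto
  have s: "0 \<le> Re s" unfolding s_def using csqrt_principal[of "(1 - w) / (1 + of_real a * w)"] by auto
  have ar: "a * r < 1" using mult_right_mono[of a 1 r] a r r0 by linarith
  have "s\<^sup>2 = (1 - w) / (1 + of_real a * w)" by (simp add: s_def)
  hence "w * (1 + of_real a * s\<^sup>2) = - ((s - 1) * (s + 1))"
    using ne by (simp add: field_simps power2_eq_square)
  hence weq: "cmod w * cmod (1 + of_real a * s\<^sup>2) = R * cmod (s + 1)"
    unfolding R_def norm_mult[symmetric] by simp
  have s1: "0 < cmod (s + 1)" by (rule less_le_trans[OF _ complex_Re_le_cmod]) (use s in simp)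
  have "R * cmod (s + 1) * (R + 2) = cmod w * (cmod (1 + of_real a * s\<^sup>2) * (R + 2))" by (simp add: weq[symmetric])
  also have "\<dots> \<le> r * (cmod (s + 1) * (1 + a * (1 + R)\<^sup>2))"
    using w cmod_one_plus_square_le[OF a(1) s] unfolding R_def[symmetric]
    by (rule mult_mono) (use w r0 R0 in auto)
  finally have "R * (R + 2) \<le> r * (1 + a * (1 + R)\<^sup>2)"
    using s1 by (simp add: mult.assoc mult.left_commute[of _ "cmod (s + 1)"])
  \<comment> \<open>Since R (R+2) = (1+R)^2 - 1, the inequality is linear in (1+R)^2.\<close>
  hence "(1 + R)\<^sup>2 * (1 - a * r) \<le> 1 + r" by (simp add: power2_eq_square algebra_simps)
  hence "(1 + R)\<^sup>2 \<le> (1 + r) / (1 - a * r)" using ar by (simp add: pos_le_divide_eq)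
  hence "1 + R \<le> sqrt ((1 + r) / (1 - a * r))" by (rule real_le_rsqrt)
  thus ?thesis by (simp add: R_def s_def)
qed

section \<open>The functions phi0 and f0 on the real axis\<close>

definition kappa :: real where "kappa = 2 * (sqrt 2 - 1)"

lemma kappa_bounds: "2071 / 2500 < kappa" "kappa < 20711 / 25000"
proof -
  \<comment> \<open>The fractions are 1.4142 and 1.41422.\<close>
  have "sqrt ((7071 / 5000)\<^sup>2) < sqrt 2" "sqrt 2 < sqrt ((70711 / 50000)\<^sup>2)"
    unfolding real_sqrt_less_iff by (simp_all add: power2_eq_square)
  thus "2071 / 2500 < kappa" "kappa < 20711 / 25000" by (simp_all add: kappa_def)
qed

lemma kappa_pos: "0 < kappa"
  using kappa_bounds(1) by linarith

definition phi0_real :: "real \<Rightarrow> real" where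
  "phi0_real r = 1 + kappa / 2 * (1 - sqrt ((1 - r) / (1 + kappa * r)))"

text \<open>On [0, 1) this is the integral of (phi0 t - 1) / t from 0 to r, in closed form. The real
  exponential form replaces the complex power in \<open>f0\<close>.\<close>

definition f0_exponent :: "real \<Rightarrow> real" where
  "f0_exponent r = (let u = sqrt (1 - r); v = sqrt (1 + kappa * r) in
     kappa * ln ((u + v) / 2) +
     sqrt kappa * arctan (sqrt kappa * ((v - u) / (v + kappa * u))))"

definition f0_real :: "real \<Rightarrow> real" where
  "f0_real r = r * exp (f0_exponent r)"

lemma phi0_eq:
  "phi0 z = 1 + of_real (kappa / 2) * (1 - csqrt ((1 - z) / (1 + of_real kappa * z)))"
proof -
  have "kappa / 2 = sqrt 2 - 1" by (simp add: kappa_def)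
  moreover have "complex_of_real (sqrt 2) = 1 + of_real (sqrt 2 - 1)" by simp
  ultimately show ?thesis unfolding phi0_def kappa_def[symmetric] by (simp only:) (simp only: algebra_simps mult_1_left)
qed

lemma one_plus_kappa_mult_pos:
  assumes "-1 < r" "r < 1"
  shows "0 < 1 + kappa * r"
proof (cases "0 \<le> r")
  case True
  thus ?thesis using kappa_pos by (simp add: add_pos_nonneg)
next
  case False
  hence "1 * r \<le> kappa * r" using kappa_bounds by (intro mult_right_mono_neg) auto
  thus ?thesis using assms by linarith
qed

lemma phi0_of_real:
  assumes "-1 < r" "r < 1"
  shows "phi0 (of_real r) = of_real (phi0_real r)"
proof -
  have "0 \<le> (1 - r) / (1 + kappa * r)"
    using one_plus_kappa_mult_pos[OF assms] assms by simp
  hence "csqrt ((1 - of_real r) / (1 + of_real kappa * of_real r)) = of_real (sqrt ((1 - r) / (1 + kappa * r)))"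
    by (simp flip: of_real_sqrt)
  thus ?thesis unfolding phi0_eq phi0_real_def by simp
qed

lemma f0_of_real:
  assumes "0 \<le> r" "r < 1"
  shows "f0 (of_real r) = of_real (f0_real r)"
proof -
  define a where "a = kappa"
  have a: "0 < a" using kappa_pos by (simp add: a_def)
  define u where "u = sqrt (1 - r)"
  define v where "v = sqrt (1 + a * r)"
  have u: "csqrt (1 - of_real r) = of_real u"
    using assms by (simp add: u_def flip: of_real_sqrt)
  have v: "csqrt (1 + of_real a * of_real r) = of_real v"
    using assms a by (simp add: v_def flip: of_real_sqrt)
  have c: "csqrt (of_real a) = of_real (sqrt a)"
    using a by (simp flip: of_real_sqrt)
  have pos: "0 < u" "0 < v" using assms a by (auto simp: u_def v_def add_pos_nonneg)
  have "f0 (of_real r) = of_real r * ((of_real u + of_real v) / 2) powr of_real a * exp (p0 (of_real r))"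
    unfolding f0_def Let_def kappa_def[symmetric] a_def[symmetric] u v ..
  also have "((of_real u + of_real v) / 2 :: complex) powr of_real a = of_real (((u + v) / 2) powr a)"
    using pos by (simp flip: powr_of_real)
  also have "p0 (of_real r) = of_real (sqrt a * arctan (sqrt a * ((v - u) / (v + a * u))))"
    unfolding p0_def Let_def kappa_def[symmetric] a_def[symmetric] u v c
    by (simp only: of_real_mult[symmetric] of_real_add[symmetric] of_real_diff[symmetric]
        of_real_divide[symmetric] Arctan_of_real)
  also have "((u + v) / 2) powr a = exp (a * ln ((u + v) / 2))"
    using pos by (simp add: powr_def)
  finally show ?thesis
    unfolding f0_real_def f0_exponent_def Let_def a_def[symmetric] u_def[symmetric] v_def[symmetric]
    by (simp only: exp_of_real of_real_mult[symmetric] exp_add mult.assoc)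
qed

text \<open>The denominator collapses: (v + a u)^2 + a (v - u)^2 = (1+a) (v^2 + a u^2) = (1+a)^2. By
  the subtraction formula, the arctangent being differentiated is arctan (sqrt a) - arctan (sqrt a *
  u / v).\<close>

lemma arctan_term_deriv_aux:
  fixes a u v :: real
  assumes "0 < a" "0 < u" "0 < v" "v\<^sup>2 + a * u\<^sup>2 = 1 + a"
  shows "a * ((a / (2 * v) + 1 / (2 * u)) * (v + a * u) - (v - u) * (a / (2 * v) - a / (2 * u)))
           / ((v + a * u)\<^sup>2 + a * (v - u)\<^sup>2) = a / (2 * u * v)"
proof -
  have "(v + a * u)\<^sup>2 + a * (v - u)\<^sup>2 = (1 + a) * (v\<^sup>2 + a * u\<^sup>2)"
    by (simp add: power2_eq_square algebra_simps)
  hence 1: "(v + a * u)\<^sup>2 + a * (v - u)\<^sup>2 = (1 + a)\<^sup>2" using assms by (simp add: power2_eq_square)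
  have 2: "(a / (2 * v) + 1 / (2 * u)) * (v + a * u) - (v - u) * (a / (2 * v) - a / (2 * u))
      = (1 + a) * (v\<^sup>2 + a * u\<^sup>2) / (2 * u * v)"
    using assms(1-3) by (simp add: field_simps power2_eq_square)
  have "1 + a \<noteq> 0" using assms(1) by simp
  thus ?thesis unfolding 1 2 assms(4) by (simp add: power2_eq_square)
qed

text \<open>The left side is the derivative of the logarithm plus that of the arctangent term; the
  right side is (phi0 r - 1) / r. The division by r comes from r (1+a) = v^2 - u^2 = (v - u) (u +
  v).\<close>

lemma f0_exponent_deriv_aux:
  fixes a u v r :: real
  assumes "0 < a" "0 < u" "0 < v" "0 < r" "u\<^sup>2 = 1 - r" "v\<^sup>2 = 1 + a * r"
  shows "a * ((a / (2 * v) - 1 / (2 * u)) / (u + v)) + a / (2 * u * v) = a / 2 * (1 - u / v) / r"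
proof -
  have "a * ((a / (2 * v) - 1 / (2 * u)) / (u + v)) + a / (2 * u * v) = a * (1 + a) / (2 * v * (u + v))"
    using assms(1-3) by (simp add: field_simps add_nonneg_eq_0_iff)
  also have "\<dots> = a / 2 * (1 - u / v) / r"
  proof -
    have "r * (1 + a) = (v - u) * (u + v)" using assms by (simp add: power2_eq_square algebra_simps)
    moreover have "a * (1 + a) / (2 * v * (u + v)) = a * (r * (1 + a)) / (r * (2 * v * (u + v)))"
      using assms(4) by simp
    moreover have "u + v \<noteq> 0" using assms(2,3) by simp
    ultimately have "a * (1 + a) / (2 * v * (u + v)) = a * (v - u) / (r * (2 * v))" by simp
    thus ?thesis using assms(3,4) by (simp add: field_simps)
  qed
  finally show ?thesis .
qed

lemma f0_exponent_has_derivative: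
  assumes r: "0 < r" "r < 1"
  shows "(f0_exponent has_real_derivative (phi0_real r - 1) / r) (at r)"
proof -
  define a where "a = kappa"
  have a: "0 < a" using kappa_pos by (simp add: a_def)
  define u where "u = (\<lambda>r. sqrt (1 - r))"
  define v where "v = (\<lambda>r. sqrt (1 + a * r))"
  have pos: "0 < u r" "0 < v r" using r a by (auto simp: u_def v_def add_pos_nonneg)
  have sq: "(u r)\<^sup>2 = 1 - r" "(v r)\<^sup>2 = 1 + a * r" using r a by (auto simp: u_def v_def)
  have du: "(u has_real_derivative - 1 / (2 * u r)) (at r)"
    using pos r unfolding u_def
    by (auto intro!: derivative_eq_intros simp: field_simps)
  have "0 < 1 + a * r" using r a by (simp add: add_pos_pos)
  hence dv: "(v has_real_derivative a / (2 * v r)) (at r)"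
    unfolding v_def by (auto intro!: derivative_eq_intros simp: field_simps)
  have w: "0 < v r + a * u r" using pos a by (simp add: add_pos_pos)
  have dT: "((\<lambda>r. (v r - u r) / (v r + a * u r)) has_real_derivative
      ((a / (2 * v r) + 1 / (2 * u r)) * (v r + a * u r) - (v r - u r) * (a / (2 * v r) - a / (2 * u r)))
           / (v r + a * u r)\<^sup>2) (at r)"
    using w by (auto intro!: derivative_eq_intros du dv simp: power2_eq_square)
  have dA: "((\<lambda>r. sqrt a * arctan (sqrt a * ((v r - u r) / (v r + a * u r)))) has_real_derivative a / (2 * u r * v r)) (at r)"
  proof -
    let ?N = "(a / (2 * v r) + 1 / (2 * u r)) * (v r + a * u r) - (v r - u r) * (a / (2 * v r) - a / (2 * u r))"
    have "((\<lambda>r. sqrt a * arctan (sqrt a * ((v r - u r) / (v r + a * u r)))) has_real_derivative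
       sqrt a * (inverse (1 + (sqrt a * ((v r - u r) / (v r + a * u r)))\<^sup>2) * (sqrt a * (?N / (v r + a * u r)\<^sup>2)))) (at r)"
      by (intro DERIV_cmult DERIV_chain2[OF DERIV_arctan] dT)
    also have "sqrt a * (inverse (1 + (sqrt a * ((v r - u r) / (v r + a * u r)))\<^sup>2) * (sqrt a * (?N / (v r + a * u r)\<^sup>2)))
      = a * ?N / ((v r + a * u r)\<^sup>2 + a * (v r - u r)\<^sup>2)"
    proof -
      have *: "sqrt a * (X * (sqrt a * Y)) = a * (X * Y)" for X Y
        using a by simp
      have **: "(1 + (sqrt a * ((v r - u r) / (v r + a * u r)))\<^sup>2) = ((v r + a * u r)\<^sup>2 + a * (v r - u r)\<^sup>2) / (v r + a * u r)\<^sup>2"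
        using w a by (simp add: power_mult_distrib power_divide add_divide_distrib)
      show ?thesis unfolding * ** using w by simp
    qed
    also have "\<dots> = a / (2 * u r * v r)"
      using a pos by (intro arctan_term_deriv_aux) (auto simp: sq algebra_simps)
    finally show ?thesis .
  qed
  have dL: "((\<lambda>r. a * ln ((u r + v r) / 2)) has_real_derivative
      a * ((a / (2 * v r) - 1 / (2 * u r)) / (u r + v r))) (at r)"
  proof -
    have *: "1 / (S / 2) * (X / 2) = X / S" for S X :: real by simp
    have "((\<lambda>r. a * ln ((u r + v r) / 2)) has_real_derivative
        a * (1 / ((u r + v r) / 2) * ((- 1 / (2 * u r) + a / (2 * v r)) / 2))) (at r)"
      using pos by (intro DERIV_cmult DERIV_chain2[OF DERIV_ln_divide] DERIV_cdivide DERIV_add du dv) simp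
    thus ?thesis unfolding * by (simp add: add.commute)
  qed
  have "f0_exponent = (\<lambda>r. a * ln ((u r + v r) / 2) + sqrt a * arctan (sqrt a * ((v r - u r) / (v r + a * u r))))"
    by (rule ext) (simp add: f0_exponent_def Let_def a_def u_def v_def)
  moreover have "(phi0_real r - 1) / r = a * ((a / (2 * v r) - 1 / (2 * u r)) / (u r + v r)) + a / (2 * u r * v r)"
    unfolding f0_exponent_deriv_aux[OF a pos r(1) sq]
    by (simp add: phi0_real_def a_def u_def v_def real_sqrt_divide)
  ultimately show ?thesis using DERIV_add[OF dL dA] by simp
qed

lemma f0_exponent_0: "f0_exponent 0 = 0"
  by (simp add: f0_exponent_def)

lemma continuous_f0_exponent:
  assumes "-1 < r" "r < 1"
  shows "isCont f0_exponent r"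
proof -
  have 1: "0 < sqrt (1 + kappa * r)" "0 < sqrt (1 - r)" "0 < kappa"
    using assms one_plus_kappa_mult_pos[OF assms] kappa_pos by auto
  hence 2: "0 < sqrt (1 + kappa * r) + kappa * sqrt (1 - r)" "0 < sqrt (1 - r) + sqrt (1 + kappa * r)"
    by (simp_all add: add_pos_pos)
  show ?thesis
    unfolding f0_exponent_def Let_def
    by (intro continuous_intros) (use 2 in auto)
qed

lemma f0_real_has_derivative:
  assumes r: "0 < r" "r < 1"
  shows "(f0_real has_real_derivative f0_real r * phi0_real r / r) (at r)"
proof -
  have "((\<lambda>r. r * exp (f0_exponent r)) has_real_derivative
      1 * exp (f0_exponent r) + exp (f0_exponent r) * ((phi0_real r - 1) / r) * r) (at r)"
    by (intro DERIV_mult DERIV_ident DERIV_fun_exp f0_exponent_has_derivative r)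
  moreover have "f0_real = (\<lambda>r. r * exp (f0_exponent r))" by (rule ext) (simp add: f0_real_def)
  moreover have "1 * exp (f0_exponent r) + exp (f0_exponent r) * ((phi0_real r - 1) / r) * r
      = f0_real r * phi0_real r / r"
    using r by (simp add: f0_real_def field_simps)
  ultimately show ?thesis by metis
qed

lemma f0_real_pos: "0 < r \<Longrightarrow> 0 < f0_real r"
  by (simp add: f0_real_def)

lemma phi0_real_ge_1:
  assumes "0 \<le> r" "r < 1"
  shows "1 \<le> phi0_real r"
proof -
  have "0 \<le> kappa * r" using assms(1) kappa_pos by (intro mult_nonneg_nonneg) linarith+
  hence "(1 - r) / (1 + kappa * r) \<le> 1" using assms by (subst divide_le_eq_1_pos) linarith+
  hence "sqrt ((1 - r) / (1 + kappa * r)) \<le> 1" by (rule real_sqrt_le_1_iff[THEN iffD2])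
  hence "0 \<le> kappa / 2 * (1 - sqrt ((1 - r) / (1 + kappa * r)))"
    using kappa_pos by (intro mult_nonneg_nonneg) linarith+
  thus ?thesis unfolding phi0_real_def by linarith
qed

lemma f0_real_strict_mono:
  assumes "0 < r" "r < s" "s < 1"
  shows "f0_real r < f0_real s"
proof (rule DERIV_pos_imp_increasing[OF assms(2)])
  fix x assume x: "r \<le> x" "x \<le> s"
  hence "0 < f0_real x * phi0_real x / x"
    using phi0_real_ge_1[of x] f0_real_pos[of x] assms by simp
  moreover have "(f0_real has_real_derivative f0_real x * phi0_real x / x) (at x)"
    using x assms by (intro f0_real_has_derivative) auto
  ultimately show "\<exists>y. (f0_real has_real_derivative y) (at x) \<and> 0 < y" by blast
qed

section \<open>Growth of the class\<close>

lemma Re_phi0_le: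
  assumes "cmod w \<le> r" "r < 1"
  shows "Re (phi0 w) \<le> phi0_real r"
proof -
  have "sqrt ((1 - r) / (1 + kappa * r)) \<le> Re (csqrt ((1 - w) / (1 + of_real kappa * w)))"
    using kappa_bounds kappa_pos assms by (intro Re_csqrt_moebius_ge) auto
  hence "kappa / 2 * (1 - Re (csqrt ((1 - w) / (1 + of_real kappa * w))))
     \<le> kappa / 2 * (1 - sqrt ((1 - r) / (1 + kappa * r)))"
    using kappa_pos by (intro mult_left_mono) auto
  thus ?thesis unfolding phi0_eq phi0_real_def
    by (simp only: plus_complex.sel minus_complex.sel times_complex.sel Re_complex_of_real
        Im_complex_of_real one_complex.sel mult_zero_left diff_zero add_le_cancel_left)
qed

lemma cmod_phi0_minus_one_le:
  assumes "cmod w \<le> r" "r < 1"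
  shows "cmod (phi0 w - 1) \<le> 1 - phi0_real (- r)"
proof -
  let ?s = "csqrt ((1 - w) / (1 + of_real kappa * w))"
  have "cmod (phi0 w - 1) = cmod (of_real (kappa / 2) * (1 - ?s))"
    unfolding phi0_eq by (simp only: add_diff_cancel_left')
  also have "\<dots> = kappa / 2 * cmod (?s - 1)"
    using kappa_pos by (simp only: norm_mult norm_of_real norm_minus_commute[of 1])
  also have "\<dots> \<le> kappa / 2 * (sqrt ((1 + r) / (1 - kappa * r)) - 1)"
    using kappa_bounds kappa_pos assms by (intro mult_left_mono cmod_csqrt_moebius_minus_one_le) auto
  also have "\<dots> = 1 - phi0_real (- r)"
    by (simp add: phi0_real_def algebra_simps)
  finally show ?thesis .
qed

lemma growth_le_f0_real:
  assumes f: "f holomorphic_on unit_disc" "f 0 = 0" "deriv f 0 = 1"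
    and quot: "\<And>w. w \<noteq> 0 \<Longrightarrow> cmod w < 1 \<Longrightarrow> Re (starlike_quotient f w) \<le> phi0_real (cmod w)"
    and z: "z \<noteq> 0" "cmod z < 1"
  shows "cmod (f z) \<le> f0_real (cmod z)"
proof -
  define e where "e = z / of_real (cmod z)"
  have e: "cmod e = 1" using z by (simp add: e_def norm_divide)
  have ze: "of_real (cmod z) * e = z" using z by (simp add: e_def)
  define F where "F = (\<lambda>t. f (of_real t * e))"
  \<comment> \<open>The squared modulus is differentiable also where F vanishes, unlike |F|.\<close>
  define P where "P = (\<lambda>t. (Re (F t))\<^sup>2 + (Im (F t))\<^sup>2)"
  have P_cmod: "P t = (cmod (F t))\<^sup>2" for t by (simp add: P_def cmod_power2)
  define Q where "Q = (\<lambda>t. P t / (f0_real t)\<^sup>2)"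
  have Q_deriv: "\<exists>y. (Q has_real_derivative y) (at t) \<and> y \<le> 0" if t: "0 < t" "t < 1" for t
  proof -
    define w where "w = of_real t * e"
    define D where "D = e * deriv f w"
    have w: "w \<noteq> 0" "cmod w = t" using t e by (auto simp: w_def norm_mult)
    have "(f has_field_derivative deriv f w) (at (of_real t * e))"
      using f(1) w t unfolding w_def[symmetric] by (intro holomorphic_derivI[of _ unit_disc]) auto
    moreover have "((\<lambda>t. of_real t * e) has_vector_derivative e) (at t)"
      by (auto intro!: derivative_eq_intros)
    ultimately have "(F has_vector_derivative D) (at t)"
      unfolding F_def D_def using field_vector_diff_chain_at[of "\<lambda>t. of_real t * e" e t f "deriv f w"]
      by (simp add: o_def)
    hence d: "((\<lambda>t. Re (F t)) has_real_derivative Re D) (at t)" "((\<lambda>t. Im (F t)) has_real_derivative Im D) (at t)"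
      by (auto intro: has_field_derivative_Re has_field_derivative_Im)
    hence P': "(P has_real_derivative 2 * Re (cnj (F t) * D)) (at t)"
      using DERIV_add[OF DERIV_power[OF d(1), of 2] DERIV_power[OF d(2), of 2]]
      by (simp add: P_def algebra_simps)
    \<comment> \<open>The left side is t P'(t) / 2. Off the zeros of F it equals P t times the real
      part of the starlike quotient; at a zero both sides are 0.\<close>
    have "t * Re (cnj (F t) * D) \<le> P t * phi0_real t"
    proof (cases "F t = 0")
      case True
      thus ?thesis by (simp add: P_def)
    next
      case False
      hence "of_real t * D = F t * starlike_quotient f w"
        using w by (simp add: starlike_quotient_def D_def F_def w_def)
      hence "of_real t * (cnj (F t) * D) = cnj (F t) * F t * starlike_quotient f w"
        by (simp only: mult.assoc mult.left_commute[of "of_real t" "cnj (F t)"])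
      also have "cnj (F t) * F t = of_real (P t)"
        unfolding P_cmod complex_norm_square by (rule mult.commute)
      finally have "t * Re (cnj (F t) * D) = P t * Re (starlike_quotient f w)"
        by (metis Re_complex_of_real Im_complex_of_real times_complex.sel(1) mult_zero_left diff_zero)
      also have "\<dots> \<le> P t * phi0_real t"
        using quot[of w] w t by (intro mult_left_mono) (auto simp: P_cmod)
      finally show ?thesis .
    qed
    hence 1: "Re (cnj (F t) * D) \<le> P t * phi0_real t / t" using t by (simp add: field_simps)
    let ?g = "f0_real t"
    have g: "0 < ?g" using t by (rule_tac f0_real_pos)
    have "(Q has_real_derivative (2 * Re (cnj (F t) * D) * ?g\<^sup>2 - P t * (2 * ?g * (?g * phi0_real t / t)))
             / (?g\<^sup>2)\<^sup>2) (at t)"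
      unfolding Q_def using g t
      by (auto intro!: derivative_eq_intros P' f0_real_has_derivative simp: power2_eq_square)
    moreover have "2 * Re (cnj (F t) * D) * ?g\<^sup>2 - P t * (2 * ?g * (?g * phi0_real t / t))
       = 2 * ?g\<^sup>2 * (Re (cnj (F t) * D) - P t * phi0_real t / t)"
      by (simp add: power2_eq_square algebra_simps)
    moreover have "2 * ?g\<^sup>2 * (Re (cnj (F t) * D) - P t * phi0_real t / t) \<le> 0"
      using 1 by (intro mult_nonneg_nonpos) auto
    ultimately show ?thesis by (metis divide_nonpos_nonneg zero_le_power2)
  qed
  \<comment> \<open>At t = 0 the HOL value of Q is 0 / 0 = 0, so the comparison uses the limit from
    the right. Cancelling t^2 in Q leaves |F t / (t e)|^2 / (exp (f0_exponent t))^2, which tends to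
    |f'(0)|^2 = 1.\<close>
  have "((\<lambda>h. (f (0 + h) - f 0) / h) \<longlongrightarrow> 1) (at 0)"
    using holomorphic_derivI[OF f(1), of 0] f(3)
    by (simp add: has_field_derivative_iff)
  hence "((\<lambda>h. f h / h) \<longlongrightarrow> 1) (at 0)" using f(2) by simp
  moreover have "filterlim (\<lambda>t. of_real t * e) (at 0) (at_right 0)"
  proof -
    have "((\<lambda>t. of_real t * e) \<longlongrightarrow> of_real 0 * e) (at_right 0)" by (intro tendsto_intros)
    moreover have "eventually (\<lambda>t. of_real t * e \<noteq> 0) (at_right 0)"
      unfolding eventually_at_right_field using e by (auto intro!: exI[of _ 1])
    ultimately show ?thesis by (simp add: filterlim_at)
  qed
  ultimately have "((\<lambda>t. F t / (of_real t * e)) \<longlongrightarrow> 1) (at_right 0)"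
    unfolding F_def by (rule filterlim_compose)
  moreover have "(f0_exponent \<longlongrightarrow> 0) (at_right 0)"
    using continuous_f0_exponent[of 0] f0_exponent_0 by (auto simp: isCont_def intro: tendsto_mono[OF at_le])
  ultimately have "((\<lambda>t. (cmod (F t / (of_real t * e)))\<^sup>2 / (exp (f0_exponent t))\<^sup>2) \<longlongrightarrow> (cmod 1)\<^sup>2 / (exp 0)\<^sup>2) (at_right 0)"
    by (intro tendsto_intros) auto
  moreover have "eventually (\<lambda>t. (cmod (F t / (of_real t * e)))\<^sup>2 / (exp (f0_exponent t))\<^sup>2 = Q t) (at_right 0)"
    unfolding eventually_at_right_field
    by (intro exI[of _ 1]) (auto simp: Q_def P_cmod norm_divide norm_mult e f0_real_def power_mult_distrib power_divide)
  ultimately have "(Q \<longlongrightarrow> 1) (at_right 0)" by (auto intro: Lim_transform_eventually)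
  moreover have "Q (cmod z) \<le> Q t" if "0 < t" "t < cmod z" for t
    by (rule DERIV_nonpos_imp_nonincreasing[OF less_imp_le[OF that(2)]])
       (rule Q_deriv, use that z(2) in linarith, use z(2) in linarith)
  hence "eventually (\<lambda>t. Q (cmod z) \<le> Q t) (at_right 0)"
    unfolding eventually_at_right_field using z(1) by (meson zero_less_norm_iff)
  ultimately have "Q (cmod z) \<le> 1" by (rule tendsto_lowerbound) simp
  hence "(cmod (f z))\<^sup>2 \<le> (f0_real (cmod z))\<^sup>2"
    using f0_real_pos[of "cmod z"] z by (simp add: Q_def P_cmod F_def ze)
  thus ?thesis by (rule power2_le_imp_le) (rule less_imp_le[OF f0_real_pos], use z in simp)
qed

section \<open>Location of the radius\<close>

text \<open>The Lagrange remainder has even order 4, so the bound holds for negative x as well;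
  there it yields upper bounds for exp through reciprocals.\<close>

lemma exp_ge_taylor_cubic: "1 + x + x\<^sup>2 / 2 + x ^ 3 / 6 \<le> exp (x :: real)"
proof -
  obtain t where "exp x = (\<Sum>m<4. x ^ m / fact m) + exp t / fact 4 * x ^ 4"
    using Maclaurin_exp_le by blast
  moreover have "(\<Sum>m<4. x ^ m / fact m) = 1 + x + x\<^sup>2 / 2 + x ^ 3 / 6"
    by (simp add: eval_nat_numeral fact_numeral)
  moreover have "0 \<le> exp t / fact 4 * x ^ 4" by simp
  ultimately show ?thesis by linarith
qed

text \<open>Partial sums of the alternating arctangent series; the factor sqrt a leaves only
  integral powers of a, so sqrt a itself needs no numerical bound.\<close>

lemma sqrt_mult_arctan_bounds:
  fixes a t :: real
  assumes "0 \<le> a" "a < 1" "0 \<le> t" "t < 1"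
  shows "sqrt a * arctan (sqrt a * t) \<le> a * t - a\<^sup>2 * t ^ 3 / 3 + a ^ 3 * t ^ 5 / 5"
    and "a * t - a\<^sup>2 * t ^ 3 / 3 + a ^ 3 * t ^ 5 / 5 - a ^ 4 * t ^ 7 / 7 \<le> sqrt a * arctan (sqrt a * t)"
proof -
  define c where "c = sqrt a"
  have c: "0 \<le> c" "c < 1" and a: "a = c\<^sup>2" using assms by (auto simp: c_def)
  have ct: "0 \<le> c * t" "c * t < 1"
    using c assms mult_strict_mono[of c 1 t 1] by auto
  have "arctan (c * t) \<le> c * t - (c * t) ^ 3 / 3 + (c * t) ^ 5 / 5"
    using arctan_upper_bound[OF ct, of 1] by (simp add: eval_nat_numeral)
  hence "c * arctan (c * t) \<le> c * (c * t - (c * t) ^ 3 / 3 + (c * t) ^ 5 / 5)"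
    using c by (intro mult_left_mono)
  thus "sqrt a * arctan (sqrt a * t) \<le> a * t - a\<^sup>2 * t ^ 3 / 3 + a ^ 3 * t ^ 5 / 5"
    unfolding c_def[symmetric] by (simp add: a eval_nat_numeral algebra_simps)
  have "c * t - (c * t) ^ 3 / 3 + (c * t) ^ 5 / 5 - (c * t) ^ 7 / 7 \<le> arctan (c * t)"
    using arctan_lower_bound[OF ct, of 2] by (simp add: eval_nat_numeral)
  hence "c * (c * t - (c * t) ^ 3 / 3 + (c * t) ^ 5 / 5 - (c * t) ^ 7 / 7) \<le> c * arctan (c * t)"
    using c by (intro mult_left_mono)
  thus "a * t - a\<^sup>2 * t ^ 3 / 3 + a ^ 3 * t ^ 5 / 5 - a ^ 4 * t ^ 7 / 7 \<le> sqrt a * arctan (sqrt a * t)"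
    unfolding c_def[symmetric] by (simp add: a eval_nat_numeral algebra_simps)
qed

definition radius_fun :: "real \<Rightarrow> real" where
  "radius_fun r = 2 * (1 - phi0_real (- r)) * f0_real r"

lemma one_minus_phi0_real:
  "1 - phi0_real (- r) = kappa / 2 * (sqrt ((1 + r) / (1 - kappa * r)) - 1)"
  by (simp add: phi0_real_def algebra_simps)

text \<open>The point is 0.768 - 0.0005. The decimals are roundings of the values there, directed so
  that the product is bounded from above; the final margin is slightly below 0.001.\<close>

lemma radius_fun_lower_point: "radius_fun (307 / 400) < 1"
proof -
  let ?r = "307 / 400 :: real"
  define k where "k = kappa"
  have k: "2071 / 2500 < k" "k < 20711 / 25000" using kappa_bounds by (auto simp: k_def)
  define u v where "u = sqrt (1 - ?r)" and "v = sqrt (1 + k * ?r)"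
  define t A S where "t = (v - u) / (v + k * u)" and "A = (u + v) / 2"
    and "S = sqrt ((1 + ?r) / (1 - k * ?r))"
  have u: "48218 / 100000 \<le> u" "u \<le> 48219 / 100000"
    unfolding u_def by (intro real_le_rsqrt real_le_lsqrt; simp add: power2_eq_square)+
  have v: "127897 / 100000 \<le> v" "v \<le> 1279 / 1000"
    unfolding v_def using k by (intro real_le_rsqrt real_le_lsqrt; simp add: power2_eq_square)+
  have ku: "2071 / 2500 * (48218 / 100000) \<le> k * u" "k * u \<le> 20711 / 25000 * (48219 / 100000)"
    using k u by (intro mult_mono; linarith)+
  have A: "0 < A" "A \<le> 8806 / 10000" using u v by (auto simp: A_def)
  have vk: "0 < v + k * u" using v ku by linarith
  have t: "4747 / 10000 \<le> t" "t \<le> 4748 / 10000"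
    unfolding t_def pos_le_divide_eq[OF vk] pos_divide_le_eq[OF vk] distrib_left using u v ku by - linarith+
  have S: "S \<le> 22032 / 10000"
    unfolding S_def using k by (intro real_le_lsqrt) (simp_all add: pos_divide_le_eq power2_eq_square)
  have "k * t \<le> 20711 / 25000 * (4748 / 10000)"
    using k t by (intro mult_mono; linarith)
  moreover have "(2071 / 2500)\<^sup>2 * (4747 / 10000) ^ 3 \<le> k\<^sup>2 * t ^ 3"
    using k t by (intro mult_mono power_mono; simp)
  moreover have "k ^ 3 * t ^ 5 \<le> (20711 / 25000) ^ 3 * (4748 / 10000) ^ 5"
    using k t by (intro mult_mono power_mono; simp)
  moreover have "sqrt k * arctan (sqrt k * t) \<le> k * t - k\<^sup>2 * t ^ 3 / 3 + k ^ 3 * t ^ 5 / 5"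
    using k t by (intro sqrt_mult_arctan_bounds) auto
  ultimately have 1: "sqrt k * arctan (sqrt k * t) \<le> 37164 / 100000"
    by (simp add: power_divide)
  \<comment> \<open>First term of the series ln (1/A) = 2 artanh ((1 - A) / (1 + A)).\<close>
  have "2 * (1 - A) / (A + 1) \<le> - ln A"
    using ln_inverse_approx_ge[of A 1] A by simp
  moreover have "1269 / 10000 \<le> 2 * (1 - A) / (A + 1)"
    using A by (subst pos_le_divide_eq; simp)
  ultimately have "1269 / 10000 \<le> - ln A" by linarith
  hence "2071 / 2500 * (1269 / 10000) \<le> k * (- ln A)"
    using k by (intro mult_mono) auto
  hence E: "f0_exponent ?r \<le> 2666 / 10000"
    using 1 unfolding f0_exponent_def Let_def k_def[symmetric] u_def[symmetric] v_def[symmetric]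
      t_def[symmetric] A_def[symmetric] by simp
  have "exp (f0_exponent ?r) \<le> exp (2666 / 10000)" using E by simp
  also have "exp (2666 / 10000) = 1 / exp (- (2666 / 10000 :: real))" by (simp add: exp_minus field_simps)
  also have "\<dots> \<le> 1 / (7657 / 10000)"
    using exp_ge_taylor_cubic[of "- (2666 / 10000)"]
    by (intro divide_left_mono) (simp_all add: power_divide power2_eq_square power3_eq_cube)
  finally have e: "exp (f0_exponent ?r) \<le> 10000 / 7657" by simp
  have "radius_fun ?r = k * (S - 1) * (?r * exp (f0_exponent ?r))"
    unfolding radius_fun_def one_minus_phi0_real f0_real_def S_def k_def by simp
  also have "\<dots> \<le> 20711 / 25000 * (22032 / 10000 - 1) * (?r * (10000 / 7657))"
    using k S e by (intro order_trans[OF mult_right_mono mult_left_mono] mult_left_mono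
        order_trans[OF mult_left_mono mult_right_mono]) auto
  also have "\<dots> < 1" by simp
  finally show ?thesis .
qed

text \<open>The point is 0.768 + 0.0005, with all roundings reversed; the arctangent sum takes one
  more term so as to end below the limit. The final margin is about 0.0005.\<close>

lemma radius_fun_upper_point: "1 < radius_fun (1537 / 2000)"
proof -
  let ?r = "1537 / 2000 :: real"
  define k where "k = kappa"
  have k: "2071 / 2500 < k" "k < 20711 / 25000" using kappa_bounds by (auto simp: k_def)
  define u v where "u = sqrt (1 - ?r)" and "v = sqrt (1 + k * ?r)"
  define t A S where "t = (v - u) / (v + k * u)" and "A = (u + v) / 2"
    and "S = sqrt ((1 + ?r) / (1 - k * ?r))"
  have u: "48114 / 100000 \<le> u" "u \<le> 48115 / 100000"
    unfolding u_def by (intro real_le_rsqrt real_le_lsqrt; simp add: power2_eq_square)+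
  have v: "127929 / 100000 \<le> v" "v \<le> 127932 / 100000"
    unfolding v_def using k by (intro real_le_rsqrt real_le_lsqrt; simp add: power2_eq_square)+
  have ku: "2071 / 2500 * (48114 / 100000) \<le> k * u" "k * u \<le> 20711 / 25000 * (48115 / 100000)"
    using k u by (intro mult_mono; linarith)+
  have A: "8802 / 10000 \<le> A" "A < 1" using u v by (auto simp: A_def)
  have vk: "0 < v + k * u" using v ku by linarith
  have t: "4756 / 10000 \<le> t" "t \<le> 47575 / 100000"
    unfolding t_def pos_le_divide_eq[OF vk] pos_divide_le_eq[OF vk] distrib_left using u v ku by - linarith+
  have S: "2206 / 1000 \<le> S"
    unfolding S_def using k by (intro real_le_rsqrt) (simp_all add: pos_le_divide_eq power2_eq_square)
  have "2071 / 2500 * (4756 / 10000) \<le> k * t"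
    using k t by (intro mult_mono; linarith)
  moreover have "k\<^sup>2 * t ^ 3 \<le> (20711 / 25000)\<^sup>2 * (47575 / 100000) ^ 3"
    using k t by (intro mult_mono power_mono; simp)
  moreover have "(2071 / 2500) ^ 3 * (4756 / 10000) ^ 5 \<le> k ^ 3 * t ^ 5"
    using k t by (intro mult_mono power_mono; simp)
  moreover have "k ^ 4 * t ^ 7 \<le> (20711 / 25000) ^ 4 * (47575 / 100000) ^ 7"
    using k t by (intro mult_mono power_mono; simp)
  moreover have "k * t - k\<^sup>2 * t ^ 3 / 3 + k ^ 3 * t ^ 5 / 5 - k ^ 4 * t ^ 7 / 7 \<le> sqrt k * arctan (sqrt k * t)"
    using k t by (intro sqrt_mult_arctan_bounds) auto
  ultimately have 1: "37173 / 100000 \<le> sqrt k * arctan (sqrt k * t)"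
    by (simp add: power_divide)
  \<comment> \<open>Trapezoidal rule for the convex function 1/x on [A, 1].\<close>
  have "ln 1 - ln A \<le> (1 - A) * (inverse A + 1) / 2"
    using ln_inverse_approx_le[of A "1 - A"] A by simp
  also have "\<dots> \<le> (1 - 8802 / 10000) * (10000 / 8802 + 1) / 2"
  proof -
    have "inverse A \<le> inverse (8802 / 10000)" using A by (intro le_imp_inverse_le) auto
    thus ?thesis using A by (intro divide_right_mono mult_mono) auto
  qed
  finally have "- ln A \<le> (1 - 8802 / 10000) * (10000 / 8802 + 1) / 2" by simp
  hence "k * (- ln A) \<le> 20711 / 25000 * ((1 - 8802 / 10000) * (10000 / 8802 + 1) / 2)"
    using k A by (intro mult_mono) auto
  hence E: "265 / 1000 \<le> f0_exponent ?r"
    using 1 unfolding f0_exponent_def Let_def k_def[symmetric] u_def[symmetric] v_def[symmetric]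
      t_def[symmetric] A_def[symmetric] by simp
  have "13032 / 10000 \<le> exp (265 / 1000 :: real)"
    using exp_ge_taylor_cubic[of "265 / 1000"]
    by (simp add: power_divide power2_eq_square power3_eq_cube)
  also have "\<dots> \<le> exp (f0_exponent ?r)" using E by simp
  finally have e: "13032 / 10000 \<le> exp (f0_exponent ?r)" .
  have "1 < 2071 / 2500 * (2206 / 1000 - 1) * (?r * (13032 / 10000))" by simp
  also have "\<dots> \<le> k * (S - 1) * (?r * exp (f0_exponent ?r))"
    using k S e by (intro mult_mono mult_nonneg_nonneg) auto
  also have "\<dots> = radius_fun ?r"
    unfolding radius_fun_def one_minus_phi0_real f0_real_def S_def k_def by simp
  finally show ?thesis .
qed

section \<open>Monotonicity of the radius function and its root\<close>

lemma one_minus_kappa_mult_pos: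
  assumes "0 \<le> r" "r < 1"
  shows "0 < 1 - kappa * r"
  using mult_right_mono[of kappa 1 r] kappa_bounds assms by linarith

lemma one_minus_phi0_real_strict_mono:
  assumes "0 \<le> r" "r < s" "s < 1"
  shows "1 - phi0_real (- r) < 1 - phi0_real (- s)"
proof -
  have "0 < 1 - kappa * s" using one_minus_kappa_mult_pos assms by simp
  moreover have "kappa * r < kappa * s" using assms kappa_pos by simp
  ultimately have "(1 + r) / (1 - kappa * r) < (1 + s) / (1 - kappa * s)"
    using assms by (intro frac_less) linarith+
  thus ?thesis unfolding one_minus_phi0_real using kappa_pos by simp
qed

lemma one_minus_phi0_real_nonneg:
  assumes "0 \<le> r" "r < 1"
  shows "0 \<le> 1 - phi0_real (- r)"
proof -
  have "0 \<le> kappa * r" using assms kappa_pos by simp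
  hence "1 \<le> (1 + r) / (1 - kappa * r)"
    unfolding pos_le_divide_eq[OF one_minus_kappa_mult_pos[OF assms]] mult_1_left using assms by linarith
  thus ?thesis unfolding one_minus_phi0_real using kappa_pos by simp
qed

text \<open>At r = 1 the square root is sqrt 2 / (sqrt 2 - 1) = 2 + sqrt 2, which makes phi0 (-1) =
  0; before r = 1 it is strictly smaller.\<close>

lemma one_minus_phi0_real_less_1:
  assumes "0 \<le> r" "r < 1"
  shows "1 - phi0_real (- r) < 1"
proof -
  define q where "q = sqrt (2 :: real)"
  have q: "q * q = 2" "1 < q" by (auto simp: q_def)
  have k: "kappa = 2 * (q - 1)" by (simp add: kappa_def q_def)
  have "(5 + 4 * q) * r < 5 + 4 * q" using mult_strict_left_mono[of r 1 "5 + 4 * q"] assms q by simp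
  \<comment> \<open>A polynomial identity in q and r; the multiple of q * q - 2 is split off so that
    q * q = 2 can be applied afterwards.\<close>
  moreover have "(2 + q)\<^sup>2 * (1 - kappa * r) - (1 + r) = (5 + 4 * q) - (5 + 4 * q) * r + (q * q - 2) * (1 - (2 * q + 6) * r)"
    unfolding k by (simp add: power2_eq_square algebra_simps)
  moreover have "(q * q - 2) * (1 - (2 * q + 6) * r) = 0" using q by simp
  ultimately have "1 + r < (2 + q)\<^sup>2 * (1 - kappa * r)" by linarith
  hence "(1 + r) / (1 - kappa * r) < (2 + q)\<^sup>2"
    using one_minus_kappa_mult_pos[OF assms] by (simp add: pos_divide_less_eq)
  hence "sqrt ((1 + r) / (1 - kappa * r)) < 2 + q" using q by (intro real_less_lsqrt) auto
  hence "kappa / 2 * (sqrt ((1 + r) / (1 - kappa * r)) - 1) < kappa / 2 * (1 + q)"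
    using kappa_pos by (intro mult_strict_left_mono) auto
  also have "\<dots> = 1" using q unfolding k by (simp add: algebra_simps)
  finally show ?thesis unfolding one_minus_phi0_real .
qed

lemma radius_fun_strict_mono:
  assumes "0 < r" "r < s" "s < 1"
  shows "radius_fun r < radius_fun s"
proof -
  have "(1 - phi0_real (- r)) * f0_real r < (1 - phi0_real (- s)) * f0_real s"
    using assms by (intro mult_strict_mono' one_minus_phi0_real_strict_mono f0_real_strict_mono
        one_minus_phi0_real_nonneg less_imp_le[OF f0_real_pos]) auto
  thus ?thesis unfolding radius_fun_def mult.assoc by linarith
qed

lemma continuous_on_radius_fun: "continuous_on {0<..<1} radius_fun"
proof -
  have "continuous_on {0<..<1} f0_real"
    by (rule DERIV_continuous_on, rule has_field_derivative_at_within, rule f0_real_has_derivative) auto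
  moreover have "continuous_on {0<..<1} (\<lambda>r. phi0_real (- r))"
    unfolding phi0_real_def using one_minus_kappa_mult_pos
    by (intro continuous_intros) (auto simp: less_imp_neq[symmetric])
  ultimately show ?thesis unfolding radius_fun_def[abs_def] by (intro continuous_intros)
qed

lemma radius_fun_root:
  obtains r0 where "307 / 400 < r0" "r0 < 1537 / 2000" "radius_fun r0 = 1"
proof -
  have "continuous_on {307 / 400..1537 / 2000} radius_fun"
    by (rule continuous_on_subset[OF continuous_on_radius_fun]) auto
  then obtain r0 where "307 / 400 \<le> r0" "r0 \<le> 1537 / 2000" "radius_fun r0 = 1"
    using IVT'[of radius_fun "307 / 400" 1 "1537 / 2000"] radius_fun_lower_point radius_fun_upper_point
    by fastforce
  \<comment> \<open>Excluding the endpoints turns the bracket into the strict bound |r0 - 0.768| <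
    0.0005.\<close>
  moreover from this have "r0 \<noteq> 307 / 400" "r0 \<noteq> 1537 / 2000"
    using radius_fun_lower_point radius_fun_upper_point by (metis less_irrefl)+
  ultimately show ?thesis using that by force
qed

section \<open>The estimate for functions of the class, and the radius theorem\<close>

lemma class_S_RL_less_half:
  assumes f: "f \<in> class_S_RL" and less: "z \<noteq> 0 \<Longrightarrow> radius_fun (cmod z) < 1" and z: "cmod z < 1"
  shows "cmod (z * deriv f z - f z) < 1 / 2"
proof (cases "z = 0")
  case True
  thus ?thesis using f by (simp add: class_S_RL_def class_A_def)
next
  case False
  obtain \<omega> where \<omega>: "\<omega> holomorphic_on unit_disc" "\<omega> ` unit_disc \<subseteq> unit_disc" "\<omega> 0 = 0"
    "\<And>w. w \<in> unit_disc \<Longrightarrow> starlike_quotient f w = phi0 (\<omega> w)"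
    using f unfolding class_S_RL_def subordinate_def by blast
  have A: "f holomorphic_on unit_disc" "f 0 = 0" "deriv f 0 = 1"
    using f by (auto simp: class_S_RL_def class_A_def)
  have schwarz: "cmod (\<omega> w) \<le> cmod w" if "cmod w < 1" for w
  proof (rule Schwarz_Lemma(1)[OF \<omega>(1,3) _ that])
    show "cmod (\<omega> v) < 1" if "cmod v < 1" for v
      using \<omega>(2) that by (auto simp: image_subset_iff)
  qed
  have growth: "cmod (f z) \<le> f0_real (cmod z)"
    using \<omega>(4) Re_phi0_le[OF schwarz] False z by (intro growth_le_f0_real A) auto
  have quot: "z * deriv f z / f z = phi0 (\<omega> z)"
    using \<omega>(4)[of z] z False by (simp add: starlike_quotient_def)
  have dist: "cmod (phi0 (\<omega> z) - 1) \<le> 1 - phi0_real (- cmod z)"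
    using schwarz z by (intro cmod_phi0_minus_one_le)
  \<comment> \<open>At a zero, HOL division makes the quotient 0, so phi0 (\<omega> z) would be 0,
    at distance 1 from 1.\<close>
  have "f z \<noteq> 0"
  proof
    assume "f z = 0"
    hence "cmod (phi0 (\<omega> z) - 1) = 1" using quot by simp
    thus False using dist one_minus_phi0_real_less_1[of "cmod z"] z by simp
  qed
  hence "z * deriv f z - f z = (phi0 (\<omega> z) - 1) * f z"
    using quot by (simp add: field_simps)
  hence "cmod (z * deriv f z - f z) = cmod (phi0 (\<omega> z) - 1) * cmod (f z)"
    by (simp only: norm_mult)
  also have "\<dots> \<le> (1 - phi0_real (- cmod z)) * f0_real (cmod z)"
    using growth dist order_trans[OF norm_ge_zero dist] by (intro mult_mono) auto
  also have "\<dots> < 1 / 2" using less[OF False] unfolding radius_fun_def mult.assoc by linarith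
  finally show ?thesis .
qed

theorem theorem2p18:
  shows "\<exists>r0::real.
     0 < r0 \<and>
     2 * (1 - phi0 (- complex_of_real r0)) * f0 (complex_of_real r0) - 1 = 0 \<and>
     (\<forall>r. 0 < r \<and> r < r0 \<longrightarrow>
        2 * (1 - phi0 (- complex_of_real r)) * f0 (complex_of_real r) - 1 \<noteq> 0) \<and>
     \<bar>r0 - 0.768\<bar> < 0.0005 \<and>
     (\<forall>f\<in>class_S_RL. f \<in> class_Omega_in r0)"
proof -
  obtain r0 where r0: "307 / 400 < r0" "r0 < 1537 / 2000" "radius_fun r0 = 1"
    by (rule radius_fun_root)
  have radius_complex:
    "2 * (1 - phi0 (- complex_of_real r)) * f0 (complex_of_real r) - 1 = of_real (radius_fun r - 1)"
    if "0 < r" "r < 1" for r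
    using phi0_of_real[of "- r"] f0_of_real[of r] that by (simp add: radius_fun_def)
  \<comment> \<open>Strict monotonicity of \<open>radius_fun\<close> serves twice: it gives
    \<open>radius_fun\<close> |z| < 1 for 0 < |z| < r0 here, and it makes r0 the smallest positive
    root below.\<close>
  have "f \<in> class_Omega_in r0" if "f \<in> class_S_RL" for f
    using class_S_RL_less_half[OF that] radius_fun_strict_mono[of _ r0] r0 that
    by (force simp: class_Omega_in_def class_S_RL_def)
  moreover have "2 * (1 - phi0 (- complex_of_real r)) * f0 (complex_of_real r) - 1 \<noteq> 0"
    if "0 < r" "r < r0" for r
    using radius_complex[of r] radius_fun_strict_mono[of r r0] r0 that by simp
  moreover have "2 * (1 - phi0 (- complex_of_real r0)) * f0 (complex_of_real r0) - 1 = 0"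
    using radius_complex[of r0] r0 by simp
  moreover have "\<bar>r0 - 0.768\<bar> < 0.0005" unfolding abs_less_iff using r0 by simp
  ultimately show ?thesis using r0(1) by (intro exI[of _ r0]) auto
qed

end
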